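(* Let $(a_j)_{j\ge1}$ be positive real weights and $A(x)=\sum_{j\ge1}a_jx^j\in(0,\infty]$ for $x>0$. Assume that the one-parameter family $(q_x)_x$, $q_x(j)=a_jx^j/A(x)$, is nonempty and regular, i.e. that the set $\{x>0:A(x)<\infty\}$ is nonempty and open. Then there is a unique $x_*>0$ with $A(x_* )=1$. The maximizing support fraction is unique and equals $\alpha_*=1/\mathbb E_{x_*}J$. If $k_n$ maximizes $k\mapsto W^{(a)}_{n,k}$ over $1\le k\le n$, then \[ \left|\frac{k_n}{n}-\alpha_*\right|=O(n^{-1/2})\qquad(n\to\infty), \] where the implicit constant depends only on the one-site law $q_{x_*}$.
   Context: For positive weights $(a_j)_{j\ge1}$ and integers $1\le k\le n$, the one-statistic microcanonical partition function is \[ W^{(a)}_{n,k}=\sum_{\substack{j_1+\cdots+j_k=n\\ j_i\ge1}}\prod_{i=1}^k a_{j_i}. \] For $x>0$ with $A(x)<\infty$, $q_x(j)=a_jx^j/A(x)$, $j\ge1$, is a probability law on $\{1,2,\dots\}$, and $\mathbb E_xJ=\sum_{j\ge1} j\,q_x(j)$ is the mean of $J\sim q_x$. The family is called regular when its natural parameter domain (the set of $\log x$ with $A(x)<\infty$) is open. The "maximizing support fraction" is the limit of $k_n/n$ as $n\to\infty$, where $k_n$ is any maximizer of $k\mapsto W^{(a)}_{n,k}$. *)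

theory Defs
  imports "HOL-Probability.Probability"
begin

text \<open>Weights are functions \<open>a :: nat \<Rightarrow> real\<close>; only the values \<open>a j\<close> with \<open>j \<ge> 1\<close> are ever used.\<close>

definition gen_fun :: "(nat \<Rightarrow> real) \<Rightarrow> real \<Rightarrow> ennreal" where
  "gen_fun a x = (\<Sum>i. ennreal (a (Suc i) * x ^ Suc i))"

definition finite_domain :: "(nat \<Rightarrow> real) \<Rightarrow> real set" where
  "finite_domain a = {x. 0 < x \<and> gen_fun a x < \<infinity>}"

definition site_law :: "(nat \<Rightarrow> real) \<Rightarrow> real \<Rightarrow> nat pmf" where
  "site_law a x = embed_pmf (\<lambda>j. if j = 0 then 0 else a j * x ^ j / enn2real (gen_fun a x))"

definition compositions :: "nat \<Rightarrow> nat \<Rightarrow> nat list set" where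
  "compositions n k = {js. length js = k \<and> (\<forall>j\<in>set js. 1 \<le> j) \<and> sum_list js = n}"

definition partition_fun :: "(nat \<Rightarrow> real) \<Rightarrow> nat \<Rightarrow> nat \<Rightarrow> real" where
  "partition_fun a n k = (\<Sum>js\<in>compositions n k. prod_list (map a js))"

definition is_maximizer :: "(nat \<Rightarrow> real) \<Rightarrow> nat \<Rightarrow> nat \<Rightarrow> bool" where
  "is_maximizer a n k \<longleftrightarrow> is_arg_max (partition_fun a n) (\<lambda>k. 1 \<le> k \<and> k \<le> n) k"

text \<open>The limit must be the same for every choice of maximizers.  At \<open>n = 0\<close> there is no
  admissible \<open>k\<close>, so the sequence is unconstrained there.\<close>

definition maximizing_support_fraction :: "(nat \<Rightarrow> real) \<Rightarrow> real \<Rightarrow> bool" where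
  "maximizing_support_fraction a \<alpha> \<longleftrightarrow>
     (\<forall>k :: nat \<Rightarrow> nat. (\<forall>n\<ge>1. is_maximizer a n (k n)) \<longrightarrow>
        (\<lambda>n. real (k n) / real n) \<longlonglongrightarrow> \<alpha>)"

text \<open>The set of compositions is finite, so the sum in \<^const>\<open>partition_fun\<close> is a genuine one,
  and \<^const>\<open>embed_pmf\<close> is applied to a genuine probability mass function.\<close>

lemma finite_compositions: "finite (compositions n k)"
proof (rule finite_subset)
  show "compositions n k \<subseteq> {js. set js \<subseteq> {..n} \<and> length js = k}"
    by (auto simp: compositions_def member_le_sum_list)
  show "finite {js. set js \<subseteq> {..n} \<and> length js = k}"
    by (rule finite_lists_length_eq) simp
qed

lemma pmf_site_law:
  assumes pos: "\<And>j. 1 \<le> j \<Longrightarrow> 0 < a j" and x: "x \<in> finite_domain a"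
  shows "pmf (site_law a x) j = (if j = 0 then 0 else a j * x ^ j / enn2real (gen_fun a x))"
proof -
  define S where "S = enn2real (gen_fun a x)"
  define f where "f = (\<lambda>j. if j = 0 then 0 else a j * x ^ j / S)"
  have x0: "0 < x" and fin: "gen_fun a x < \<infinity>"
    using x by (auto simp: finite_domain_def)
  have nonneg: "0 \<le> a (Suc i) * x ^ Suc i" for i
    using pos[of "Suc i"] x0 by (intro mult_nonneg_nonneg) auto
  have "ennreal (a 1 * x) \<le> gen_fun a x"
    unfolding gen_fun_def
    using sum_le_suminf[of "\<lambda>i. ennreal (a (Suc i) * x ^ Suc i)" "{0}"] by simp
  moreover have "0 < a 1 * x"
    using pos[of 1] x0 by simp
  ultimately have "0 < gen_fun a x"
    by (metis ennreal_less_zero_iff less_le_trans)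
  then have S0: "0 < S" and S: "ennreal S = gen_fun a x"
    using fin by (auto simp: S_def enn2real_positive_iff)
  have f0: "0 \<le> f j" for j
    using pos[of j] x0 S0 by (auto simp: f_def intro!: divide_nonneg_pos mult_nonneg_nonneg less_imp_le)
  have "(\<integral>\<^sup>+ j. ennreal (f j) \<partial>count_space UNIV) = (\<Sum>j. ennreal (f j))"
    by (rule nn_integral_count_space_nat)
  also have "\<dots> = (\<Sum>i. ennreal (f (Suc i)))"
    using suminf_offset[of "\<lambda>j. ennreal (f j)" 1] by (simp add: f_def)
  also have "\<dots> = (\<Sum>i. ennreal (a (Suc i) * x ^ Suc i) / ennreal S)"
    using nonneg S0 by (intro suminf_cong) (simp add: f_def divide_ennreal)
  also have "\<dots> = gen_fun a x / ennreal S"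
    by (simp add: gen_fun_def)
  also have "\<dots> = 1"
    using S0 by (simp add: S[symmetric] divide_ennreal)
  finally have "pmf (embed_pmf f) j = f j"
    using f0 by (intro pmf_embed_pmf)
  then show ?thesis
    by (simp only: site_law_def f_def S_def)
qed

end

theory Submission
  imports Defs "HOL-Real_Asymp.Real_Asymp"
begin

text \<open>
  Tilt the weights to \<open>q j = a j * x ^ j\<close> with \<open>x = x\<^sub>*\<close>.  Since \<open>A(x\<^sub>*) = 1\<close>, no normalisation is
  needed and \<open>x ^ n * W\<^bsub>n,k\<^esub>\<close> is exactly the probability \<open>p\<^sub>k(n)\<close> that a sum \<open>S\<^sub>k\<close> of \<open>k\<close> independent
  copies of \<open>J \<sim> q\<close> equals \<open>n\<close>; it is the coefficient \<open>hit k n\<close> of the \<open>k\<close>-th power of the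
  generating function of \<open>q\<close>.  The factor \<open>x ^ n\<close> does not involve \<open>k\<close>, so for fixed \<open>n\<close> the
  maximizers of \<open>W\<close> are those of \<open>p\<^sub>k(n)\<close>, which is a matter of the law \<open>q\<close> alone.  Write \<open>\<mu>\<close> for
  its mean and \<open>\<alpha> = 1 / \<mu>\<close>.

  The rate \<open>n powr (-1/2)\<close> comes from playing an upper bound off against a lower bound, without any
  local limit theorem.

  Upper bound (\<open>hit_decay\<close>): \<open>p\<^sub>k(n) * (n - k * \<mu>)\<^sup>2 \<le> D * sqrt n\<close>.  The spread bound
  \<open>p\<^sub>k(n) \<le> c / sqrt (k + 1)\<close> (\<open>hit_concentration\<close>) is not enough, since it does not see the deviation.
  Splitting \<open>S\<^sub>k\<close> into two independent halves combines it with the variance: a deviation of \<open>S\<^sub>k\<close> is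
  shared between the halves, one half pays for it through its second moment, and the other half must
  still hit a prescribed value, which costs \<open>c / sqrt k\<close>.

  Lower bound (\<open>renewal_bounded_below\<close>): \<open>\<Sum>k. p\<^sub>k(n)\<close> is the probability that the random walk with
  steps \<open>J\<close> visits \<open>n\<close>, and this is bounded below because \<open>J\<close> has a finite mean and charges \<open>1\<close>.

  By the upper bound the \<open>k\<close> with \<open>\<bar>k - \<alpha> * n\<bar> \<ge> K * sqrt n\<close> contribute \<open>O(1 / K)\<close> to this sum.  For
  large \<open>K\<close> the at most \<open>3 * K * sqrt n\<close> remaining \<open>k\<close> thus carry a fixed amount of mass, so the maximum
  of \<open>p\<^sub>k(n)\<close> over \<open>k\<close> is at least a constant times \<open>1 / sqrt n\<close>.  Inserting this in the upper bound
  at a maximizer gives \<open>(k - \<alpha> * n)\<^sup>2 = O(n)\<close> (\<open>arg_max_hit_near_mean\<close>).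

  Openness of the domain is used twice: it forces \<open>A\<close> to reach the value \<open>1\<close>
  (\<open>gen_fun_eq_1_exists\<close>), and it gives \<open>q\<close> a finite second moment (\<open>site_sequence_site_law\<close>).
\<close>

unbundle no vec_syntax
unbundle fps_syntax

section \<open>Powers of nonnegative power series\<close>

lemma convolution_sums:
  fixes f g :: "nat \<Rightarrow> real"
  assumes "summable (\<lambda>n. \<bar>f n\<bar>)" "summable (\<lambda>n. \<bar>g n\<bar>)" "f sums s" "g sums t"
  shows "(\<lambda>n. \<Sum>i=0..n. f i * g (n - i)) sums (s * t)"
  using Cauchy_product_sums[of f g] assms by (simp add: sums_iff atMost_atLeast0)

lemma fps_mult_nonneg:
  fixes F G :: "real fps"
  assumes "\<And>n. 0 \<le> F $ n" "\<And>n. 0 \<le> G $ n"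
  shows "0 \<le> (F * G) $ n"
  using assms by (auto simp: fps_mult_nth intro!: sum_nonneg)

lemma fps_power_nonneg:
  fixes F :: "real fps"
  assumes "\<And>n. 0 \<le> F $ n"
  shows "0 \<le> (F ^ k) $ n"
proof (induction k arbitrary: n)
  case (Suc k)
  then show ?case by (auto intro!: fps_mult_nonneg assms)
qed simp

lemma fps_power_sums:
  fixes F :: "real fps"
  assumes nn: "\<And>n. 0 \<le> F $ n" and s: "fps_nth F sums s"
  shows "fps_nth (F ^ k) sums (s ^ k)"
proof (induction k)
  case 0
  have "(\<lambda>n. (1 :: real fps) $ n) sums (1 :: real)"
    using sums_single[of 0 "\<lambda>_. 1 :: real"] by (simp add: eq_commute)
  then show ?case by simp
next
  case (Suc k)
  have "(\<lambda>n. \<Sum>i=0..n. F $ i * (F ^ k) $ (n - i)) sums (s * s ^ k)"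
    using s Suc nn fps_power_nonneg[OF nn]
    by (intro convolution_sums) (auto simp: sums_iff)
  then show ?case by (simp add: fps_mult_nth)
qed

text \<open>Adding an independent summand cannot make a law more concentrated: the supremum of the first factor
  survives convolution with a law of mass \<open>s\<close>.\<close>

lemma fps_mult_nth_le:
  fixes F G :: "real fps"
  assumes F: "\<And>n. 0 \<le> F $ n" "\<And>n. F $ n \<le> c" and G: "\<And>n. 0 \<le> G $ n" "fps_nth G sums s"
  shows "(F * G) $ n \<le> c * s"
proof -
  have c: "0 \<le> c" using F order_trans by blast
  have "(F * G) $ n = (\<Sum>i=0..n. F $ i * G $ (n - i))" by (simp add: fps_mult_nth)
  also have "\<dots> \<le> (\<Sum>i=0..n. c * G $ (n - i))"
    using F G by (intro sum_mono mult_right_mono) auto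
  also have "\<dots> = c * (\<Sum>i=0..n. G $ (n - i))" by (simp add: sum_distrib_left)
  also have "(\<Sum>i=0..n. G $ (n - i)) = (\<Sum>i<Suc n. G $ i)"
    by (rule sum.reindex_bij_witness[of _ "\<lambda>i. n - i" "\<lambda>i. n - i"]) auto
  also have "c * \<dots> \<le> c * s"
    using G sum_le_suminf[of "fps_nth G" "{..<Suc n}"] c
    by (intro mult_left_mono) (auto simp: sums_iff)
  finally show ?thesis .
qed

section \<open>Concentration\<close>

text \<open>The square of the familiar bound \<open>4 ^ m / sqrt (2 * m + 1)\<close> for the central coefficient.  The induction
  step is \<open>(2 * m + 1) * (2 * m + 3) \<le> (2 * m + 2)\<^sup>2\<close>.\<close>

lemma central_binomial_sq_le: "(2 * real m + 1) * (real ((2 * m) choose m))\<^sup>2 \<le> 16 ^ m"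
proof (induction m)
  case (Suc m)
  define c where "c = real ((2 * m) choose m)"
  define d where "d = real ((2 * Suc m) choose Suc m)"
  have "Suc m * ((2 * Suc m) choose Suc m) = (2 * Suc m) * ((2 * m + 1) choose m)"
    using Suc_times_binomial_eq[of "2 * m + 1" m] by (simp add: mult.commute)
  moreover have "Suc m * ((2 * m + 1) choose m) = (2 * m + 1) * ((2 * m) choose m)"
    using Suc_times_binomial_eq[of "2 * m" m] binomial_symmetric[of m "2 * m + 1"]
    by (simp add: mult.commute)
  ultimately have "Suc m * (Suc m * ((2 * Suc m) choose Suc m)) = (2 * Suc m) * ((2 * m + 1) * ((2 * m) choose m))"
    by (metis mult.left_commute)
  then have "Suc m * ((2 * Suc m) choose Suc m) = 2 * ((2 * m + 1) * ((2 * m) choose m))"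
    by (metis Suc_mult_cancel1 mult.assoc mult.commute)
  then have "real (Suc m * ((2 * Suc m) choose Suc m)) = real (2 * ((2 * m + 1) * ((2 * m) choose m)))"
    by (rule arg_cong)
  then have e: "(real m + 1) * d = 2 * (2 * real m + 1) * c"
    by (simp add: d_def c_def algebra_simps)
  have "(real m + 1)\<^sup>2 * ((2 * real m + 3) * d\<^sup>2) = (2 * real m + 3) * ((real m + 1) * d)\<^sup>2"
    by (simp add: power2_eq_square algebra_simps)
  also have "\<dots> = 4 * ((2 * real m + 3) * (2 * real m + 1)) * ((2 * real m + 1) * c\<^sup>2)"
    unfolding e by (simp add: power2_eq_square algebra_simps)
  also have "\<dots> \<le> 4 * (4 * (real m + 1)\<^sup>2) * 16 ^ m"
  proof (rule mult_mono)
    show "4 * ((2 * real m + 3) * (2 * real m + 1)) \<le> 4 * (4 * (real m + 1)\<^sup>2)"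
      by (simp add: power2_eq_square algebra_simps)
    show "(2 * real m + 1) * c\<^sup>2 \<le> 16 ^ m" using Suc by (simp add: c_def)
  qed auto
  finally have "(real m + 1)\<^sup>2 * ((2 * real m + 3) * d\<^sup>2) \<le> (real m + 1)\<^sup>2 * 16 ^ Suc m"
    by simp
  then have "(2 * real m + 3) * d\<^sup>2 \<le> 16 ^ Suc m"
    by (rule mult_left_le_imp_le) (auto simp: power2_eq_square)
  then show ?case by (simp add: d_def algebra_simps)
qed simp

text \<open>Reduces to the central coefficient; for odd \<open>m = 2 * i + 1\<close> that one is half of the coefficient in the
  middle of row \<open>2 * i + 2\<close>.\<close>

lemma binomial_le_pow2_div_sqrt: "real (m choose j) \<le> 2 ^ m / sqrt (real m + 1)"
proof -
  have "(real m + 1) * (real (m choose (m div 2)))\<^sup>2 \<le> (2 ^ m)\<^sup>2"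
  proof (cases "even m")
    case True
    then obtain i where i: "m = 2 * i" by blast
    have "(16 :: real) ^ i = (2 ^ 4) ^ i" by simp
    also have "\<dots> = (2 ^ m)\<^sup>2"
      unfolding power_mult [symmetric] by (simp add: i)
    finally have "(16 :: real) ^ i = (2 ^ m)\<^sup>2" .
    then show ?thesis using central_binomial_sq_le[of i] by (simp add: i)
  next
    case False
    then obtain i where i: "m = 2 * i + 1" by (auto elim: oddE)
    have "(2 * Suc i) choose Suc i = 2 * ((2 * i + 1) choose i)"
      using binomial_symmetric[of i "2 * i + 1"] by simp
    then have e: "real ((2 * Suc i) choose Suc i) = 2 * real (m choose (m div 2))"
      by (simp add: i)
    have "(16 :: real) ^ Suc i = (2 ^ 4) ^ Suc i" by simp
    also have "\<dots> = 2\<^sup>2 * (2 ^ m)\<^sup>2"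
      unfolding power_mult [symmetric] power_add [symmetric] by (simp add: i power_add)
    finally have p: "(16 :: real) ^ Suc i = 4 * (2 ^ m)\<^sup>2" by simp
    have "(2 * real (Suc i) + 1) * (2 * real (m choose (m div 2)))\<^sup>2 \<le> 4 * (2 ^ m)\<^sup>2"
      using central_binomial_sq_le[of "Suc i"] unfolding e p .
    moreover have "(real m + 1) * (real (m choose (m div 2)))\<^sup>2
        \<le> (2 * real (Suc i) + 1) * (real (m choose (m div 2)))\<^sup>2"
      by (intro mult_right_mono) (auto simp: i)
    ultimately show ?thesis by (simp add: power_mult_distrib)
  qed
  then have "sqrt ((real m + 1) * (real (m choose (m div 2)))\<^sup>2) \<le> 2 ^ m"
    by (intro real_le_lsqrt) auto
  then have "sqrt (real m + 1) * real (m choose (m div 2)) \<le> 2 ^ m"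
    by (simp add: real_sqrt_mult)
  then have "sqrt (real m + 1) * real (m choose j) \<le> 2 ^ m"
  proof (rule order.trans[rotated])
    show "sqrt (real m + 1) * real (m choose j) \<le> sqrt (real m + 1) * real (m choose (m div 2))"
      using binomial_maximum[of m j] by (intro mult_left_mono) auto
  qed
  then show ?thesis
    by (simp add: pos_le_divide_eq mult.commute)
qed

lemma one_plus_fps_X_power_nth: "((1 + fps_X) ^ m :: real fps) $ i = real (m choose i)"
proof (induction m arbitrary: i)
  case (Suc m)
  then show ?case by (cases i) (auto simp: distrib_right)
qed simp

text \<open>The \<open>m\<close>-fold convolution of the measure with mass \<open>b\<close> at \<open>1\<close> and at \<open>2\<close> is a shifted multiple of a row of
  Pascal's triangle.\<close>

lemma fps_two_point_power_nth_le:
  assumes "0 \<le> b"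
  shows "0 \<le> ((fps_const b * (fps_X + fps_X\<^sup>2)) ^ m) $ i"
    and "((fps_const b * (fps_X + fps_X\<^sup>2)) ^ m) $ i \<le> (2 * b) ^ m / sqrt (real m + 1)"
proof -
  have "fps_const b * (fps_X + fps_X\<^sup>2) = fps_const b * (fps_X * (1 + fps_X))"
    by (simp add: power2_eq_square algebra_simps)
  then have "(fps_const b * (fps_X + fps_X\<^sup>2)) ^ m = fps_const (b ^ m) * (fps_X ^ m * (1 + fps_X) ^ m)"
    by (simp only: power_mult_distrib fps_const_power)
  then have e: "((fps_const b * (fps_X + fps_X\<^sup>2)) ^ m) $ i = b ^ m * (if i < m then 0 else real (m choose (i - m)))"
    by (simp only: fps_mult_left_const_nth fps_X_power_mult_nth one_plus_fps_X_power_nth)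
  show "0 \<le> ((fps_const b * (fps_X + fps_X\<^sup>2)) ^ m) $ i"
    unfolding e using assms by auto
  have "((fps_const b * (fps_X + fps_X\<^sup>2)) ^ m) $ i \<le> b ^ m * (2 ^ m / sqrt (real m + 1))"
    unfolding e using assms binomial_le_pow2_div_sqrt[of m "i - m"] by (intro mult_left_mono) auto
  then show "((fps_const b * (fps_X + fps_X\<^sup>2)) ^ m) $ i \<le> (2 * b) ^ m / sqrt (real m + 1)"
    by (simp add: power_mult_distrib mult.commute)
qed

text \<open>The mean of \<open>1 / (X + 1)\<close> for binomial \<open>X\<close>.  By \<open>(k choose m) / (m + 1) = (k + 1 choose m + 1) / (k + 1)\<close> the
  sum is, up to the factor \<open>(k + 1) * s\<close>, a binomial distribution with its first term missing.\<close>

lemma sum_binomial_inverse_Suc_le: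
  assumes "0 < (s :: real)" "s \<le> 1"
  shows "(\<Sum>m\<le>k. real (k choose m) * s ^ m * (1 - s) ^ (k - m) / (real m + 1)) \<le> 1 / ((real k + 1) * s)"
proof -
  define g where "g = (\<lambda>m. real (Suc k choose m) * s ^ m * (1 - s) ^ (Suc k - m))"
  have "(\<Sum>m\<le>k. real (k choose m) * s ^ m * (1 - s) ^ (k - m) / (real m + 1)) = (\<Sum>m\<le>k. g (Suc m) / ((real k + 1) * s))"
  proof (intro sum.cong refl)
    fix m
    have "real (Suc k * (k choose m)) = real ((Suc k choose Suc m) * Suc m)"
      using Suc_times_binomial_eq by (rule arg_cong)
    then have "real (k choose m) * (real k + 1) = real (Suc k choose Suc m) * (real m + 1)"
      unfolding of_nat_mult of_nat_Suc by (simp only: mult.commute add.commute)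
    then have e: "real (k choose m) = real (Suc k choose Suc m) * (real m + 1) / (real k + 1)"
      by (subst nonzero_eq_divide_eq) auto
    then show "real (k choose m) * s ^ m * (1 - s) ^ (k - m) / (real m + 1) = g (Suc m) / ((real k + 1) * s)"
      unfolding e g_def using assms by (simp del: binomial_Suc_Suc add: mult_ac)
  qed
  also have "\<dots> = (\<Sum>m\<le>k. g (Suc m)) / ((real k + 1) * s)" by (simp add: sum_divide_distrib)
  also have "(\<Sum>m\<le>k. g (Suc m)) \<le> (\<Sum>m\<le>Suc k. g m)"
    using assms by (subst sum.atMost_Suc_shift) (auto simp: g_def)
  also have "\<dots> = (s + (1 - s)) ^ Suc k" unfolding g_def by (subst binomial_ring) simp
  finally show ?thesis using assms by (simp add: divide_right_mono)
qed

text \<open>The passage from \<open>1 / (X + 1)\<close> to \<open>1 / sqrt (X + 1)\<close> is Jensen's inequality, here in the linearised form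
  \<open>1 / y \<le> (r / 2) * (1 / y\<^sup>2) + 1 / (2 * r)\<close> with the optimal \<open>r = sqrt ((k + 1) * s)\<close>.\<close>

lemma sum_binomial_inverse_sqrt_Suc_le:
  assumes "0 < (s :: real)" "s \<le> 1"
  shows "(\<Sum>m\<le>k. real (k choose m) * s ^ m * (1 - s) ^ (k - m) / sqrt (real m + 1)) \<le> 1 / sqrt ((real k + 1) * s)"
proof -
  define w where "w = (\<lambda>m. real (k choose m) * s ^ m * (1 - s) ^ (k - m))"
  define r where "r = sqrt ((real k + 1) * s)"
  have r: "0 < r" "(real k + 1) * s = r * r" using assms by (auto simp: r_def)
  have w: "0 \<le> w m" for m using assms by (auto simp: w_def)
  have "(\<Sum>m\<le>k. w m) = (s + (1 - s)) ^ k" unfolding w_def by (subst binomial_ring) simp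
  then have w1: "(\<Sum>m\<le>k. w m) = 1" by simp
  have "(\<Sum>m\<le>k. w m / sqrt (real m + 1)) \<le> (\<Sum>m\<le>k. (r / 2) * (w m / (real m + 1)) + w m * (1 / (2 * r)))"
  proof (intro sum_mono)
    fix m
    define y where "y = sqrt (real m + 1)"
    have y: "0 < y" "real m + 1 = y * y" by (auto simp: y_def)
    have "1 / y \<le> r / 2 * (1 / (y * y)) + 1 / (2 * r)"
    proof -
      have "2 * (r * y) \<le> r * r + y * y"
        using zero_le_power2[of "r - y"] by (simp add: power2_eq_square algebra_simps)
      then show ?thesis using y r by (simp add: field_simps)
    qed
    from mult_left_mono[OF this w[of m]]
    show "w m / sqrt (real m + 1) \<le> (r / 2) * (w m / (real m + 1)) + w m * (1 / (2 * r))"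
      using y(1) unfolding y_def[symmetric] y(2) by (simp add: algebra_simps)
  qed
  also have "\<dots> = (r / 2) * (\<Sum>m\<le>k. w m / (real m + 1)) + (\<Sum>m\<le>k. w m) * (1 / (2 * r))"
    unfolding sum.distrib sum_distrib_left sum_distrib_right ..
  also have "\<dots> \<le> (r / 2) * (1 / (r * r)) + 1 * (1 / (2 * r))"
    using sum_binomial_inverse_Suc_le[OF assms, of k] r w1 unfolding w_def
    by (intro add_mono mult_left_mono) auto
  also have "\<dots> = 1 / r" using r by (simp add: field_simps)
  finally show ?thesis by (simp add: w_def r_def)
qed

text \<open>Splitting off mass \<open>b\<close> at each of \<open>1\<close> and \<open>2\<close> writes every step as a mixture.  Among \<open>k\<close> steps a binomial
  number \<open>m\<close> with success probability \<open>2 * b\<close> comes from the two-point part, whose \<open>m\<close>-fold sum is spread over about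
  \<open>sqrt m\<close> values; the other steps do not undo this.\<close>

lemma fps_power_nth_concentration:
  fixes F :: "real fps"
  assumes nn: "\<And>n. 0 \<le> F $ n" and s: "fps_nth F sums 1"
    and b: "0 < b" "b \<le> F $ 1" "b \<le> F $ 2" "2 * b \<le> 1"
  shows "(F ^ k) $ n \<le> 1 / sqrt ((real k + 1) * (2 * b))"
proof -
  define B where "B = fps_const b * (fps_X + fps_X\<^sup>2)"
  define R where "R = F - B"
  have Bn: "B $ i = (if i = 1 then b else 0) + (if i = 2 then b else 0)" for i
    by (simp add: B_def fps_X_nth fps_X_power_nth distrib_left)
  have "fps_nth B sums (b + b)"
    unfolding Bn[abs_def] by (intro sums_add sums_single)
  then have R: "fps_nth R sums (1 - 2 * b)"
    using sums_diff[OF s, of "fps_nth B" "b + b"] by (simp add: R_def sums_def)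
  have R0: "0 \<le> R $ i" for i using nn[of i] b by (auto simp: R_def Bn)
  have "F ^ k = (B + R) ^ k" by (simp add: R_def)
  also have "\<dots> = (\<Sum>m\<le>k. of_nat (k choose m) * B ^ m * R ^ (k - m))" by (rule binomial_ring)
  finally have "(F ^ k) $ n = (\<Sum>m\<le>k. real (k choose m) * (B ^ m * R ^ (k - m)) $ n)"
    by (simp add: fps_sum_nth mult.assoc flip: fps_of_nat)
  also have "\<dots> \<le> (\<Sum>m\<le>k. real (k choose m) * ((2 * b) ^ m / sqrt (real m + 1) * (1 - 2 * b) ^ (k - m)))"
    using fps_two_point_power_nth_le[of b] b fps_power_nonneg[OF R0] fps_power_sums[OF R0 R]
    by (intro sum_mono mult_left_mono fps_mult_nth_le) (auto simp: B_def)
  also have "\<dots> \<le> 1 / sqrt ((real k + 1) * (2 * b))"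
    using sum_binomial_inverse_sqrt_Suc_le[of "2 * b" k] b by (simp add: mult.assoc)
  finally show ?thesis .
qed

section \<open>Sums of independent sites\<close>

lemma summable_abs_mult_of_square:
  fixes x w :: "nat \<Rightarrow> real"
  assumes "\<And>n. 0 \<le> w n" "summable w" "summable (\<lambda>n. (x n)\<^sup>2 * w n)"
  shows "summable (\<lambda>n. \<bar>x n * w n\<bar>)"
proof (rule summable_comparison_test')
  show "summable (\<lambda>n. w n + (x n)\<^sup>2 * w n)" using assms by (intro summable_add)
  fix n :: nat
  have "0 \<le> (\<bar>x n\<bar> - 1)\<^sup>2" by simp
  then have "\<bar>x n\<bar> \<le> 1 + (x n)\<^sup>2"
    by (simp add: power2_diff)
  then have "\<bar>x n\<bar> * w n \<le> (1 + (x n)\<^sup>2) * w n" using assms by (intro mult_right_mono) auto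
  then show "norm \<bar>x n * w n\<bar> \<le> w n + (x n)\<^sup>2 * w n"
    using assms by (simp add: abs_mult algebra_simps)
qed

text \<open>The locale captures the law \<open>q\<close> of one site as a plain sequence.  The tilted weights satisfy its
  assumptions by \<open>site_sequence_site_law\<close>.\<close>

locale site_sequence =
  fixes q :: "nat \<Rightarrow> real"
  assumes q_zero: "q 0 = 0"
    and q_pos: "1 \<le> j \<Longrightarrow> 0 < q j"
    and sums_one: "q sums 1"
    and second_moment: "summable (\<lambda>j. (real j)\<^sup>2 * q j)"
begin

text \<open>The probability that \<open>k\<close> independent sites add up to \<open>n\<close>: convolution of laws is multiplication of
  generating functions.\<close>

definition hit :: "nat \<Rightarrow> nat \<Rightarrow> real" where
  "hit k n = (Abs_fps q ^ k) $ n"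

definition mean :: real where
  "mean = (\<Sum>j. real j * q j)"

definition variance :: real where
  "variance = (\<Sum>j. (real j - mean)\<^sup>2 * q j)"

lemma q_nonneg: "0 \<le> q j"
  using q_zero q_pos[of j] by (cases j) auto

lemma hit_nonneg: "0 \<le> hit k n"
  unfolding hit_def by (rule fps_power_nonneg) (simp add: q_nonneg)

lemma hit_sums: "hit k sums 1"
  using fps_power_sums[of "Abs_fps q" 1 k] by (simp add: hit_def[abs_def] q_nonneg sums_one Abs_fps_inverse)

lemma hit_add: "hit (k + l) n = (\<Sum>i=0..n. hit k i * hit l (n - i))"
  by (simp add: hit_def power_add fps_mult_nth)

lemma hit_1: "hit 1 = q"
  by (simp add: hit_def fun_eq_iff)

lemma hit_Suc: "hit (Suc k) n = (\<Sum>i=0..n. q i * hit k (n - i))"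
  using hit_add[of 1 k n] by (simp add: hit_1[simplified])

lemma hit_eq_0: "n < k \<Longrightarrow> hit k n = 0"
  using startsby_zero_power_prefix[of "Abs_fps q" k] q_zero by (simp add: hit_def)

lemma first_moment_summable: "summable (\<lambda>j. real j * q j)"
  using summable_abs_mult_of_square[OF q_nonneg _ second_moment] sums_one q_nonneg
  by (simp add: sums_iff)

lemma mean_sums: "(\<lambda>j. real j * q j) sums mean"
  using first_moment_summable by (simp add: mean_def summable_sums)

lemma mean_ge_1: "1 \<le> mean"
proof -
  have "q j \<le> real j * q j" for j
    using mult_right_mono[OF _ q_nonneg[of j], of 1 "real j"] q_zero by (cases j) auto
  then show ?thesis using sums_le[OF _ sums_one mean_sums] by auto
qed

lemma variance_sums: "(\<lambda>j. (real j - mean)\<^sup>2 * q j) sums variance"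
proof -
  have "summable (\<lambda>j. (real j)\<^sup>2 * q j - 2 * mean * (real j * q j) + mean\<^sup>2 * q j)"
    using second_moment first_moment_summable sums_one
    by (intro summable_add summable_diff summable_mult) (auto simp: sums_iff)
  then have "summable (\<lambda>j. (real j - mean)\<^sup>2 * q j)"
    by (simp add: power2_diff algebra_simps)
  then show ?thesis by (simp add: variance_def summable_sums)
qed

lemma variance_nonneg: "0 \<le> variance"
  using sums_le[OF _ sums_zero variance_sums] q_nonneg by simp

lemma centred_sums: "(\<lambda>j. (real j - mean) * q j) sums 0"
  using sums_diff[OF mean_sums sums_mult[OF sums_one, of mean]] by (simp add: algebra_simps)

text \<open>Mean and variance of sums of independent variables, as Cauchy products.  Both statements go through one
  induction, because the cross term of the expanded square vanishes by the first one.\<close>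

lemma hit_moments:
  "(\<lambda>n. (real n - real k * mean) * hit k n) sums 0
   \<and> (\<lambda>n. (real n - real k * mean)\<^sup>2 * hit k n) sums (real k * variance)"
proof (induction k)
  case 0
  have "(\<lambda>n. (real n - real 0 * mean) * hit 0 n) = (\<lambda>_. 0)"
    "(\<lambda>n. (real n - real 0 * mean)\<^sup>2 * hit 0 n) = (\<lambda>_. 0)"
    by (auto simp: hit_def fun_eq_iff)
  then show ?case by simp
next
  case (Suc k)
  define x where "x = (\<lambda>i. real i - mean)"
  define y where "y = (\<lambda>i. real i - real k * mean)"
  have q: "q sums 1" "(\<lambda>i. x i * q i) sums 0" "(\<lambda>i. (x i)\<^sup>2 * q i) sums variance"
    using sums_one centred_sums variance_sums by (auto simp: x_def)
  have h: "hit k sums 1" "(\<lambda>i. y i * hit k i) sums 0" "(\<lambda>i. (y i)\<^sup>2 * hit k i) sums (real k * variance)"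
    using hit_sums Suc by (auto simp: y_def)
  have aq: "summable (\<lambda>i. \<bar>q i\<bar>)" "summable (\<lambda>i. \<bar>x i * q i\<bar>)" "summable (\<lambda>i. \<bar>(x i)\<^sup>2 * q i\<bar>)"
    using q summable_abs_mult_of_square[OF q_nonneg, where x = x] by (auto simp: sums_iff q_nonneg)
  have ah: "summable (\<lambda>i. \<bar>hit k i\<bar>)" "summable (\<lambda>i. \<bar>y i * hit k i\<bar>)" "summable (\<lambda>i. \<bar>(y i)\<^sup>2 * hit k i\<bar>)"
    using h summable_abs_mult_of_square[where w = "hit k" and x = y] by (auto simp: sums_iff hit_nonneg)
  have c: "real n - real (Suc k) * mean = x i + y (n - i)" if "i \<in> {0..n}" for i n
    using that by (simp add: x_def y_def of_nat_diff algebra_simps)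
  have "(\<lambda>n. (\<Sum>i=0..n. x i * q i * hit k (n - i)) + (\<Sum>i=0..n. q i * (y (n - i) * hit k (n - i))))
      sums (0 * 1 + 1 * 0)"
    by (intro sums_add convolution_sums q h aq ah)
  also have "(\<lambda>n. (\<Sum>i=0..n. x i * q i * hit k (n - i)) + (\<Sum>i=0..n. q i * (y (n - i) * hit k (n - i))))
      = (\<lambda>n. (real n - real (Suc k) * mean) * hit (Suc k) n)"
  proof
    fix n
    show "(\<Sum>i=0..n. x i * q i * hit k (n - i)) + (\<Sum>i=0..n. q i * (y (n - i) * hit k (n - i)))
      = (real n - real (Suc k) * mean) * hit (Suc k) n"
      unfolding hit_Suc sum_distrib_left sum.distrib[symmetric]
      by (intro sum.cong refl) (simp only: c, simp add: algebra_simps)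
  qed
  finally have 1: "(\<lambda>n. (real n - real (Suc k) * mean) * hit (Suc k) n) sums 0" by simp
  have "(\<lambda>n. (\<Sum>i=0..n. (x i)\<^sup>2 * q i * hit k (n - i))
        + 2 * (\<Sum>i=0..n. x i * q i * (y (n - i) * hit k (n - i)))
        + (\<Sum>i=0..n. q i * ((y (n - i))\<^sup>2 * hit k (n - i))))
      sums (variance * 1 + 2 * (0 * 0) + 1 * (real k * variance))"
    by (intro sums_add sums_mult convolution_sums q h aq ah)
  also have "(\<lambda>n. (\<Sum>i=0..n. (x i)\<^sup>2 * q i * hit k (n - i))
        + 2 * (\<Sum>i=0..n. x i * q i * (y (n - i) * hit k (n - i)))
        + (\<Sum>i=0..n. q i * ((y (n - i))\<^sup>2 * hit k (n - i))))
      = (\<lambda>n. (real n - real (Suc k) * mean)\<^sup>2 * hit (Suc k) n)"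
  proof
    fix n
    show "(\<Sum>i=0..n. (x i)\<^sup>2 * q i * hit k (n - i))
        + 2 * (\<Sum>i=0..n. x i * q i * (y (n - i) * hit k (n - i)))
        + (\<Sum>i=0..n. q i * ((y (n - i))\<^sup>2 * hit k (n - i)))
      = (real n - real (Suc k) * mean)\<^sup>2 * hit (Suc k) n"
      unfolding hit_Suc sum_distrib_left sum.distrib[symmetric]
      by (intro sum.cong refl) (simp only: c, simp add: power2_sum algebra_simps)
  qed
  finally show ?case using 1 by (simp add: algebra_simps)
qed

lemma hit_concentration: "\<exists>c>0. \<forall>k n. hit k n \<le> c / sqrt (real k + 1)"
proof -
  define b where "b = min (q 1) (q 2)"
  have "(\<Sum>j\<in>{1, 2}. q j) \<le> 1"
    using sum_le_suminf[of q "{1, 2}"] sums_one q_nonneg by (simp add: sums_iff)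
  then have b: "0 < b" "b \<le> q 1" "b \<le> q 2" "2 * b \<le> 1"
    using q_pos[of 1] q_pos[of 2] by (auto simp: b_def)
  have "hit k n \<le> (1 / sqrt (2 * b)) / sqrt (real k + 1)" for k n
  proof -
    have "sqrt ((real k + 1) * (2 * b)) = sqrt (2 * b) * sqrt (real k + 1)"
      unfolding real_sqrt_mult by (rule mult.commute)
    then show ?thesis
      using fps_power_nth_concentration[of "Abs_fps q" b k n] q_nonneg sums_one b
      by (simp add: hit_def Abs_fps_inverse)
  qed
  then show ?thesis using b by (intro exI[of _ "1 / sqrt (2 * b)"]) auto
qed

text \<open>For \<open>S\<^bsub>k+l\<^esub> = X + Y\<close> with centred parts \<open>x\<close> and \<open>y\<close>, the bound \<open>(x + y)\<^sup>2 \<le> 2 * x\<^sup>2 + 2 * y\<^sup>2\<close> charges the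
  deviation to one part at a time.  In each of the two sums that part is summed out and yields its variance,
  while the other part has a prescribed value and yields the concentration bound.\<close>

lemma hit_times_square_le:
  assumes c: "\<And>k n. hit k n \<le> c / sqrt (real k + 1)"
  shows "(real n - real (k + l) * mean)\<^sup>2 * hit (k + l) n
    \<le> 2 * (c / sqrt (real l + 1) * (real k * variance) + c / sqrt (real k + 1) * (real l * variance))"
proof -
  define x where "x = (\<lambda>k i. real i - real k * mean)"
  have half: "(\<Sum>i=0..n. (x k i)\<^sup>2 * hit k i * hit l (n - i)) \<le> c / sqrt (real l + 1) * (real k * variance)" for k l
  proof -
    have "(\<Sum>i=0..n. (x k i)\<^sup>2 * hit k i * hit l (n - i)) \<le> (\<Sum>i=0..n. (x k i)\<^sup>2 * hit k i * (c / sqrt (real l + 1)))"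
      using c by (intro sum_mono mult_left_mono) (auto simp: hit_nonneg)
    also have "\<dots> = c / sqrt (real l + 1) * (\<Sum>i=0..n. (x k i)\<^sup>2 * hit k i)"
      by (simp add: sum_distrib_left mult.commute)
    also have "\<dots> \<le> c / sqrt (real l + 1) * (real k * variance)"
    proof (rule mult_left_mono)
      show "0 \<le> c / sqrt (real l + 1)" using c[of l 0] hit_nonneg[of l 0] by linarith
      show "(\<Sum>i=0..n. (x k i)\<^sup>2 * hit k i) \<le> real k * variance"
        using sum_le_suminf[of "\<lambda>i. (x k i)\<^sup>2 * hit k i" "{0..n}"] hit_moments[of k]
        by (simp add: sums_iff hit_nonneg x_def)
    qed
    finally show ?thesis .
  qed
  have "(real n - real (k + l) * mean)\<^sup>2 * hit (k + l) n
      = (\<Sum>i=0..n. (x k i + x l (n - i))\<^sup>2 * (hit k i * hit l (n - i)))"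
    unfolding hit_add sum_distrib_left
    by (intro sum.cong refl) (simp add: x_def of_nat_diff algebra_simps)
  also have "\<dots> \<le> (\<Sum>i=0..n. 2 * ((x k i)\<^sup>2 * hit k i * hit l (n - i)) + 2 * ((x l (n - i))\<^sup>2 * hit l (n - i) * hit k i))"
  proof (intro sum_mono)
    fix i
    have "(x k i + x l (n - i))\<^sup>2 \<le> 2 * (x k i)\<^sup>2 + 2 * (x l (n - i))\<^sup>2"
      using zero_le_power2[of "x k i - x l (n - i)"] by (simp add: power2_sum power2_diff)
    then have "(x k i + x l (n - i))\<^sup>2 * (hit k i * hit l (n - i))
        \<le> (2 * (x k i)\<^sup>2 + 2 * (x l (n - i))\<^sup>2) * (hit k i * hit l (n - i))"
      by (rule mult_right_mono) (simp add: hit_nonneg)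
    then show "(x k i + x l (n - i))\<^sup>2 * (hit k i * hit l (n - i))
        \<le> 2 * ((x k i)\<^sup>2 * hit k i * hit l (n - i)) + 2 * ((x l (n - i))\<^sup>2 * hit l (n - i) * hit k i)"
      by (simp add: algebra_simps)
  qed
  also have "\<dots> = 2 * (\<Sum>i=0..n. (x k i)\<^sup>2 * hit k i * hit l (n - i))
      + 2 * (\<Sum>i=0..n. (x l (n - i))\<^sup>2 * hit l (n - i) * hit k i)"
    by (simp add: sum.distrib sum_distrib_left)
  also have "(\<Sum>i=0..n. (x l (n - i))\<^sup>2 * hit l (n - i) * hit k i) = (\<Sum>i=0..n. (x l i)\<^sup>2 * hit l i * hit k (n - i))"
    by (rule sum.reindex_bij_witness[of _ "\<lambda>i. n - i" "\<lambda>i. n - i"]) auto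
  finally show ?thesis using half[of k l] half[of l k] by (simp add: distrib_left)
qed

text \<open>Two nearly equal halves make both concentration factors of order \<open>1 / sqrt k\<close>, so that the total is of order
  \<open>k / sqrt k \<le> sqrt n\<close>.\<close>

lemma hit_decay: "\<exists>D>0. \<forall>k n. 1 \<le> k \<and> k \<le> n \<longrightarrow> hit k n * (real n - real k * mean)\<^sup>2 \<le> D * sqrt (real n)"
proof -
  obtain c where c: "0 < c" "\<And>k n. hit k n \<le> c / sqrt (real k + 1)"
    using hit_concentration by blast
  \<comment> \<open>The summand \<open>1\<close> only serves to make \<open>D\<close> positive.\<close>
  define D where "D = 2 * c * sqrt 2 * variance + 1"
  have "hit k n * (real n - real k * mean)\<^sup>2 \<le> D * sqrt (real n)" if k: "1 \<le> k" "k \<le> n" for k n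
  proof -
    define i j where "i = k div 2" and "j = k - k div 2"
    have ij: "k = i + j" "real k \<le> 2 * (real i + 1)" "real k \<le> 2 * (real j + 1)"
      using k by (auto simp: i_def j_def)
    have s: "c / sqrt (real m + 1) \<le> c * sqrt 2 / sqrt (real k)" if "real k \<le> 2 * (real m + 1)" for m
    proof -
      have "sqrt (real k) \<le> sqrt 2 * sqrt (real m + 1)"
        using that by (simp flip: real_sqrt_mult)
      then have "c * sqrt (real k) \<le> c * (sqrt 2 * sqrt (real m + 1))"
        using c by (intro mult_left_mono) auto
      then show ?thesis using k c by (simp add: field_simps)
    qed
    have "(real n - real k * mean)\<^sup>2 * hit k n \<le> 2 * (c / sqrt (real j + 1) * (real i * variance) + c / sqrt (real i + 1) * (real j * variance))"
      unfolding ij(1) by (rule hit_times_square_le[OF c(2)])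
    also have "\<dots> \<le> 2 * (c * sqrt 2 / sqrt (real k) * (real i * variance) + c * sqrt 2 / sqrt (real k) * (real j * variance))"
      using s ij variance_nonneg by (intro mult_left_mono add_mono mult_right_mono) auto
    also have "\<dots> = 2 * (c * sqrt 2 * variance) * (real k / sqrt (real k))"
      by (simp add: ij(1) add_divide_distrib algebra_simps)
    also have "real k / sqrt (real k) = sqrt (real k)" by (simp add: real_div_sqrt)
    also have "2 * (c * sqrt 2 * variance) * sqrt (real k) \<le> D * sqrt (real n)"
      using k c variance_nonneg by (intro mult_mono) (auto simp: D_def)
    finally show ?thesis by (simp add: mult.commute)
  qed
  moreover have "0 < D" using c variance_nonneg by (auto simp: D_def intro!: add_nonneg_pos)
  ultimately show ?thesis by blast
qed

section \<open>A lower bound for renewal probabilities\<close>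

text \<open>The probability that the random walk with steps \<open>q\<close> visits \<open>n\<close>; it takes at least one unit per step, so at
  most \<open>n\<close> steps matter.\<close>

definition renewal :: "nat \<Rightarrow> real" where
  "renewal n = (\<Sum>k\<le>n. hit k n)"

definition tail :: "nat \<Rightarrow> real" where
  "tail i = 1 - (\<Sum>j\<le>i. q j)"

lemma renewal_nonneg: "0 \<le> renewal n"
  by (simp add: renewal_def hit_nonneg sum_nonneg)

lemma sum_q_le_1: "finite A \<Longrightarrow> sum q A \<le> 1"
  using sum_le_suminf[of q A] sums_one q_nonneg by (simp add: sums_iff)

lemma tail_bounds: "0 \<le> tail i" "tail i \<le> 1"
  using sum_q_le_1[of "{..i}"] sum_nonneg[of "{..i}" q] q_nonneg by (auto simp: tail_def)

text \<open>Chebyshev's bound \<open>tail i \<le> M / (i + 1)\<^sup>2\<close> with the second moment \<open>M\<close>.\<close>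

lemma tail_summable: "summable tail"
proof (rule summable_comparison_test')
  define M where "M = (\<Sum>j. (real j)\<^sup>2 * q j)"
  show "summable (\<lambda>i. M * inverse ((real (Suc i))\<^sup>2))"
    using inverse_power_summable[of 2, where 'a = real]
    by (intro summable_mult) (subst summable_Suc_iff, simp)
  fix i :: nat
  have "(\<lambda>j. q (j + Suc i)) sums tail i"
    using sums_split_initial_segment[OF sums_one, of "Suc i"] by (simp add: tail_def lessThan_Suc_atMost)
  then have "(\<lambda>j. (real (Suc i))\<^sup>2 * q (j + Suc i)) sums ((real (Suc i))\<^sup>2 * tail i)"
    by (rule sums_mult)
  moreover have "(\<lambda>j. (real (j + Suc i))\<^sup>2 * q (j + Suc i)) sums (M - (\<Sum>j<Suc i. (real j)\<^sup>2 * q j))"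
    using second_moment unfolding M_def by (intro sums_split_initial_segment summable_sums)
  moreover have "(real (Suc i))\<^sup>2 * q (j + Suc i) \<le> (real (j + Suc i))\<^sup>2 * q (j + Suc i)" for j
    by (intro mult_right_mono power_mono) (auto simp: q_nonneg)
  ultimately have "(real (Suc i))\<^sup>2 * tail i \<le> M - (\<Sum>j<Suc i. (real j)\<^sup>2 * q j)"
    by (meson sums_le)
  also have "\<dots> \<le> M"
    using sum_nonneg[of "{..<Suc i}" "\<lambda>j. (real j)\<^sup>2 * q j"] q_nonneg by (simp del: sum.lessThan_Suc)
  finally show "norm (tail i) \<le> M * inverse ((real (Suc i))\<^sup>2)"
    using tail_bounds[of i] by (simp add: field_simps)
qed

text \<open>Decomposition by the last visited site \<open>n - i\<close> not beyond \<open>n\<close>: the next step must be longer than \<open>i\<close>.  In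
  generating functions, \<open>(1 - Q) * (1 + Q + \<dots> + Q ^ n) = 1 - Q ^ (n + 1)\<close>, multiplied by \<open>G = 1 / (1 - X)\<close>, which
  forms partial sums; the last power has no coefficients up to \<open>n\<close>.\<close>

lemma renewal_tail: "(\<Sum>i\<le>n. renewal (n - i) * tail i) = 1"
proof -
  define Q where "Q = Abs_fps q"
  define G :: "real fps" where "G = Abs_fps (\<lambda>_. 1)"
  have T: "((1 - Q) * G) $ i = tail i" for i
    by (simp add: left_diff_distrib Q_def G_def fps_mult_nth tail_def atMost_atLeast0)
  have R: "(\<Sum>k\<le>n. Q ^ k) $ m = renewal m" if "m \<le> n" for m
  proof -
    have "(\<Sum>k\<le>n. Q ^ k) $ m = (\<Sum>k\<le>n. hit k m)" by (simp add: fps_sum_nth hit_def Q_def)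
    also have "\<dots> = renewal m"
      unfolding renewal_def using that by (intro sum.mono_neutral_right) (auto simp: hit_eq_0)
    finally show ?thesis .
  qed
  have "(Q ^ Suc n) $ m = 0" if "m \<le> n" for m
    using hit_eq_0[of m "Suc n"] that by (simp add: hit_def Q_def)
  then have z: "(Q ^ Suc n * G) $ n = 0" by (simp add: fps_mult_nth)
  have "(\<Sum>i\<le>n. renewal (n - i) * tail i) = (((1 - Q) * G) * (\<Sum>k\<le>n. Q ^ k)) $ n"
    unfolding fps_mult_nth[of "(1 - Q) * G"] atMost_atLeast0
    by (intro sum.cong refl) (simp add: T R flip: atMost_atLeast0)
  also have "((1 - Q) * G) * (\<Sum>k\<le>n. Q ^ k) = ((1 - Q) * (\<Sum>k\<le>n. Q ^ k)) * G"
    by (simp add: mult_ac)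
  also have "\<dots> = G - Q ^ Suc n * G"
    unfolding sum_gp_basic by (simp add: left_diff_distrib)
  also have "\<dots> $ n = 1" using z by (simp add: G_def)
  finally show ?thesis .
qed

lemma renewal_le_1: "renewal n \<le> 1"
proof -
  have "(\<Sum>i\<in>{0}. renewal (n - i) * tail i) \<le> (\<Sum>i\<le>n. renewal (n - i) * tail i)"
    by (intro sum_mono2) (auto simp: renewal_nonneg tail_bounds)
  then show ?thesis using renewal_tail[of n] by (simp add: tail_def q_zero)
qed

lemma renewal_Suc_ge: "q 1 * renewal n \<le> renewal (Suc n)"
proof -
  have "q 1 * hit k n \<le> hit (Suc k) (Suc n)" for k
    using member_le_sum[of 1 "{0..Suc n}" "\<lambda>i. q i * hit k (Suc n - i)"]
    by (simp add: hit_Suc q_nonneg hit_nonneg)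
  then have "q 1 * renewal n \<le> (\<Sum>k\<le>n. hit (Suc k) (Suc n))"
    by (auto simp: renewal_def sum_distrib_left intro!: sum_mono)
  also have "\<dots> \<le> renewal (Suc n)"
    unfolding renewal_def by (subst sum.atMost_Suc_shift) (simp add: hit_nonneg)
  finally show ?thesis .
qed

lemma renewal_diff_le: "i \<le> n \<Longrightarrow> q 1 ^ i * renewal (n - i) \<le> renewal n"
proof (induction i)
  case (Suc i)
  have "q 1 ^ Suc i * renewal (n - Suc i) = q 1 ^ i * (q 1 * renewal (n - Suc i))" by simp
  also have "\<dots> \<le> q 1 ^ i * renewal (n - i)"
    using renewal_Suc_ge[of "n - Suc i"] Suc.prems q_nonneg
    by (intro mult_left_mono) (auto simp: Suc_diff_Suc)
  also have "\<dots> \<le> renewal n" using Suc by simp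
  finally show ?case .
qed simp

text \<open>As the tails are summable, in \<open>renewal_tail\<close> the visits at distance \<open>L\<close> or more from \<open>n\<close> account for at most
  \<open>1 / 2\<close>.  From a visit at distance \<open>i < L\<close> the walk reaches \<open>n\<close> by \<open>i\<close> unit steps, at the bounded cost
  \<open>q 1 ^ i\<close>.\<close>

lemma renewal_bounded_below: "\<exists>c>0. \<forall>n. c \<le> renewal n"
proof -
  have q1: "0 < q 1" by (simp add: q_pos)
  obtain L where L: "\<And>n. L \<le> n \<Longrightarrow> norm (\<Sum>i. tail (i + n)) < 1 / 2"
    using suminf_exist_split[OF _ tail_summable, of "1 / 2"] by auto
  define B where "B = (\<Sum>i<L. inverse (q 1 ^ i))"
  have B: "0 \<le> B" using q1 by (auto simp: B_def intro!: sum_nonneg)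
  have "1 \<le> 2 * (renewal n * B)" for n
  proof -
    have "1 = (\<Sum>i\<le>n. renewal (n - i) * tail i)" by (simp add: renewal_tail)
    also have "\<dots> \<le> (\<Sum>i\<le>n. (if i < L then renewal n * inverse (q 1 ^ i) else 0) + (if i < L then 0 else tail i))"
    proof (intro sum_mono)
      fix i assume "i \<in> {..n}"
      then have "renewal (n - i) \<le> renewal n * inverse (q 1 ^ i)"
        using renewal_diff_le[of i n] q1 by (simp add: field_simps)
      moreover have "renewal (n - i) * tail i \<le> renewal (n - i) * 1"
        using tail_bounds renewal_nonneg by (intro mult_left_mono) auto
      moreover have "renewal (n - i) * tail i \<le> 1 * tail i"
        using tail_bounds renewal_le_1 by (intro mult_right_mono) auto
      ultimately show "renewal (n - i) * tail i
        \<le> (if i < L then renewal n * inverse (q 1 ^ i) else 0) + (if i < L then 0 else tail i)"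
        by auto
    qed
    also have "\<dots> = (\<Sum>i\<le>n. if i < L then renewal n * inverse (q 1 ^ i) else 0) + (\<Sum>i\<le>n. if i < L then 0 else tail i)"
      by (simp add: sum.distrib)
    also have "(\<Sum>i\<le>n. if i < L then renewal n * inverse (q 1 ^ i) else 0) \<le> renewal n * B"
    proof -
      have "(\<Sum>i\<le>n. if i < L then renewal n * inverse (q 1 ^ i) else 0) = (\<Sum>i\<in>{..n} \<inter> {..<L}. renewal n * inverse (q 1 ^ i))"
        by (simp add: sum.inter_restrict del: One_nat_def)
      also have "\<dots> \<le> (\<Sum>i<L. renewal n * inverse (q 1 ^ i))"
        using q1 renewal_nonneg by (intro sum_mono2) auto
      finally show ?thesis by (simp add: B_def sum_distrib_left)
    qed
    also have "(\<Sum>i\<le>n. if i < L then 0 else tail i) \<le> 1 / 2"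
    proof -
      have "(\<Sum>i\<le>n. if i < L then 0 else tail i) \<le> (\<Sum>i<n + 1 + L. if i < L then 0 else tail i)"
        by (intro sum_mono2) (auto simp: tail_bounds)
      also have "\<dots> = (\<Sum>i=0 + L..<n + 1 + L. tail i)"
        by (intro sum.mono_neutral_cong_right) auto
      also have "\<dots> = (\<Sum>i<n + 1. tail (i + L))"
        by (simp only: sum.shift_bounds_nat_ivl atLeast0LessThan)
      also have "\<dots> \<le> (\<Sum>i. tail (i + L))"
        by (intro sum_le_suminf) (auto simp: tail_bounds summable_iff_shift tail_summable)
      also have "\<dots> \<le> 1 / 2" using L[of L] by simp
      finally show ?thesis .
    qed
    finally show ?thesis by simp
  qed
  then have "1 / (2 * B + 1) \<le> renewal n" for n
    using B renewal_nonneg[of n] by (simp add: field_simps) (smt (verit) mult.commute mult.left_commute)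
  then show ?thesis using B by (intro exI[of _ "1 / (2 * B + 1)"]) auto
qed
end

section \<open>Localisation of the maximizer\<close>

text \<open>Comparison with a telescoping sum: \<open>1 / s\<^sup>2 \<le> 1 / (s - 1 / 2) - 1 / (s + 1 / 2)\<close>.\<close>

lemma sum_inverse_square_above:
  fixes t R :: real
  assumes "finite A" and A: "\<And>k. k \<in> A \<Longrightarrow> t + R \<le> real k" and R: "1 \<le> R"
  shows "(\<Sum>k\<in>A. 1 / (real k - t)\<^sup>2) \<le> 2 / R"
proof -
  define m where "m = nat \<lceil>t + R\<rceil>"
  define g where "g = (\<lambda>k. - (1 / (real k - t - 1 / 2)))"
  have m: "t + R \<le> real m" unfolding m_def by linarith
  obtain N where N: "A \<subseteq> {m..N}" "m \<le> N"
  proof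
    show "A \<subseteq> {m..Max (insert m A)}"
    proof
      fix k assume k: "k \<in> A"
      then have "m \<le> k" using A[OF k] unfolding m_def by linarith
      then show "k \<in> {m..Max (insert m A)}" using k \<open>finite A\<close> by simp
    qed
  qed (use \<open>finite A\<close> in simp)
  have "(\<Sum>k\<in>A. 1 / (real k - t)\<^sup>2) \<le> (\<Sum>k=m..N. 1 / (real k - t)\<^sup>2)"
    using N by (intro sum_mono2) auto
  also have "\<dots> \<le> (\<Sum>k=m..N. g (Suc k) - g k)"
  proof (intro sum_mono)
    fix k assume "k \<in> {m..N}"
    then have "1 \<le> real k - t" using m R by auto
    then obtain s where s: "s = real k - t" "1 \<le> s" by auto
    have "g (Suc k) - g k = 1 / (s - 1 / 2) - 1 / (s + 1 / 2)"
      by (simp add: g_def s(1) algebra_simps)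
    also have "\<dots> = 1 / ((s - 1 / 2) * (s + 1 / 2))"
      using s(2) by (subst diff_frac_eq) auto
    also have "(s - 1 / 2) * (s + 1 / 2) = s\<^sup>2 - 1 / 4"
      by (simp add: power2_eq_square algebra_simps)
    finally have "g (Suc k) - g k = 1 / (s\<^sup>2 - 1 / 4)" .
    moreover have "1 / s\<^sup>2 \<le> 1 / (s\<^sup>2 - 1 / 4)"
      using one_le_power[OF s(2), of 2] by (intro divide_left_mono mult_pos_pos) auto
    ultimately show "1 / (real k - t)\<^sup>2 \<le> g (Suc k) - g k" by (simp add: s(1))
  qed
  also have "\<dots> = g (Suc N) - g m" using N by (intro sum_Suc_diff) simp
  also have "\<dots> \<le> - g m"
    using m R N by (auto simp: g_def intro!: divide_nonneg_nonneg)
  also have "\<dots> \<le> 1 / (R / 2)"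
    unfolding g_def using m R by (simp only: minus_minus) (intro divide_left_mono mult_pos_pos; simp)
  finally show ?thesis by simp
qed


text \<open>The reflection \<open>k \<mapsto> N - k\<close> turns this into the previous case.\<close>

lemma sum_inverse_square_below:
  fixes t R :: real
  assumes "finite A" and A: "\<And>k. k \<in> A \<Longrightarrow> real k \<le> t - R" and R: "1 \<le> R"
  shows "(\<Sum>k\<in>A. 1 / (real k - t)\<^sup>2) \<le> 2 / R"
proof (cases "A = {}")
  case False
  define N where "N = Max A"
  have N: "N \<in> A" "\<And>k. k \<in> A \<Longrightarrow> k \<le> N" using False \<open>finite A\<close> by (auto simp: N_def)
  have "(\<Sum>k\<in>A. 1 / (real k - t)\<^sup>2) = (\<Sum>k\<in>(\<lambda>k. N - k) ` A. 1 / (real k - (real N - t))\<^sup>2)"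
  proof (rule sum.reindex_bij_witness[of _ "\<lambda>k. N - k" "\<lambda>k. N - k"])
    fix k assume "k \<in> A"
    then have "real (N - k) - (real N - t) = - (real k - t)" using N by (simp add: of_nat_diff)
    then show "1 / (real (N - k) - (real N - t))\<^sup>2 = 1 / (real k - t)\<^sup>2"
      by (metis power2_minus)
  qed (use N in auto)
  also have "\<dots> \<le> 2 / R"
    using \<open>finite A\<close> A[OF N(1)] R by (intro sum_inverse_square_above) auto
  finally show ?thesis .
qed (use R in simp)

lemma card_nat_near_le:
  fixes t R :: real
  assumes A: "\<And>k. k \<in> A \<Longrightarrow> \<bar>real k - t\<bar> < R" and R: "1 \<le> R"
  shows "finite A" "real (card A) \<le> 3 * R"
proof -
  have sub: "int ` A \<subseteq> {\<lceil>t - R\<rceil>..\<lfloor>t + R\<rfloor>}"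
  proof
    fix i assume "i \<in> int ` A"
    then obtain k where "k \<in> A" "i = int k" by auto
    with A[of k] show "i \<in> {\<lceil>t - R\<rceil>..\<lfloor>t + R\<rfloor>}"
      by (auto simp: abs_less_iff ceiling_le_iff le_floor_iff)
  qed
  then have fin: "finite (int ` A)" by (rule finite_subset) simp
  then show "finite A" by (rule finite_imageD) simp
  have "card A = card (int ` A)" by (simp add: card_image)
  also have "\<dots> \<le> card {\<lceil>t - R\<rceil>..\<lfloor>t + R\<rfloor>}" using sub by (intro card_mono) auto
  also have "\<dots> = nat (\<lfloor>t + R\<rfloor> - \<lceil>t - R\<rceil> + 1)" by simp
  finally have "real (card A) \<le> real (nat (\<lfloor>t + R\<rfloor> - \<lceil>t - R\<rceil> + 1))" by simp
  then show "real (card A) \<le> 3 * R" using R by linarith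
qed

context site_sequence
begin

text \<open>The maximum \<open>M\<close> of \<open>hit k n\<close> over \<open>k\<close> is at least of order \<open>1 / sqrt n\<close>, because a fixed share of the renewal
  probability sits on the \<open>k\<close> within \<open>R = K * sqrt n\<close> of \<open>t = n / mean\<close>.  On the other hand \<open>hit_decay\<close> bounds \<open>M\<close>
  by \<open>D * sqrt n / (k - t)\<^sup>2\<close> at every maximizer \<open>k\<close>.\<close>

lemma arg_max_hit_near_mean:
  "\<exists>C. \<forall>n k. 1 \<le> n \<and> is_arg_max (\<lambda>k. hit k n) (\<lambda>k. 1 \<le> k \<and> k \<le> n) k \<longrightarrow>
     \<bar>real k / real n - 1 / mean\<bar> \<le> C * real n powr (- 1 / 2)"
proof -
  obtain D where D: "0 < D"
    "\<And>k n. 1 \<le> k \<Longrightarrow> k \<le> n \<Longrightarrow> hit k n * (real n - real k * mean)\<^sup>2 \<le> D * sqrt (real n)"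
    using hit_decay by blast
  obtain c where c: "0 < c" "\<And>n. c \<le> renewal n"
    using renewal_bounded_below by blast
  \<comment> \<open>With \<open>K \<ge> 8 * D / c\<close> the two far ranges carry at most \<open>4 * D / K \<le> c / 2\<close>, half of the available mass.\<close>
  define K where "K = max 1 (8 * D / c)"
  have K: "1 \<le> K" "8 * D / c \<le> K" by (auto simp: K_def)
  \<comment> \<open>Twice the \<open>3 * K\<close> from counting the near range, as only mass \<open>c / 2\<close> is left for it.\<close>
  define C where "C = sqrt (6 * K * D / c)"
  have "\<bar>real k / real n - 1 / mean\<bar> \<le> C * real n powr (- 1 / 2)"
    if n: "1 \<le> n" and k: "is_arg_max (\<lambda>k. hit k n) (\<lambda>k. 1 \<le> k \<and> k \<le> n) k" for n k
  proof -
    define t where "t = real n / mean"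
    define R where "R = K * sqrt (real n)"
    define M where "M = hit k n"
    have k1: "1 \<le> k" "k \<le> n" and kmax: "\<And>j. 1 \<le> j \<Longrightarrow> j \<le> n \<Longrightarrow> hit j n \<le> M"
      using k by (auto simp: is_arg_max_linorder M_def)
    have n0: "1 \<le> sqrt (real n)" using n by simp
    have R: "1 \<le> R" using mult_mono[of 1 K 1 "sqrt (real n)"] K n0 by (simp add: R_def)
    have decay: "hit j n * (real j - t)\<^sup>2 \<le> D * sqrt (real n)" if "1 \<le> j" "j \<le> n" for j
    proof -
      have "real n - real j * mean = mean * (t - real j)"
        using mean_ge_1 by (simp add: t_def field_simps)
      then have "(real n - real j * mean)\<^sup>2 = mean\<^sup>2 * (real j - t)\<^sup>2"
        by (simp add: power_mult_distrib power2_commute)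
      moreover have "1 * (real j - t)\<^sup>2 \<le> mean\<^sup>2 * (real j - t)\<^sup>2"
        using mean_ge_1 by (intro mult_right_mono) auto
      ultimately have "hit j n * (real j - t)\<^sup>2 \<le> hit j n * (real n - real j * mean)\<^sup>2"
        by (intro mult_left_mono) (auto simp: hit_nonneg)
      with D(2)[OF that] show ?thesis by simp
    qed
    define Near Above Below where "Near = {j \<in> {1..n}. \<bar>real j - t\<bar> < R}"
      and "Above = {j \<in> {1..n}. t + R \<le> real j}" and "Below = {j \<in> {1..n}. real j \<le> t - R}"
    have far: "(\<Sum>j\<in>A. hit j n) \<le> D * sqrt (real n) * (2 / R)"
      if "A \<subseteq> {1..n}" "\<And>j. j \<in> A \<Longrightarrow> R \<le> \<bar>real j - t\<bar>" "(\<Sum>j\<in>A. 1 / (real j - t)\<^sup>2) \<le> 2 / R" for A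
    proof -
      have "(\<Sum>j\<in>A. hit j n) \<le> (\<Sum>j\<in>A. D * sqrt (real n) * (1 / (real j - t)\<^sup>2))"
      proof (intro sum_mono)
        fix j assume j: "j \<in> A"
        then have "0 < (real j - t)\<^sup>2" using that(2)[OF j] R by auto
        then show "hit j n \<le> D * sqrt (real n) * (1 / (real j - t)\<^sup>2)"
          using decay[of j] j that(1) by (auto simp: field_simps)
      qed
      also have "\<dots> = D * sqrt (real n) * (\<Sum>j\<in>A. 1 / (real j - t)\<^sup>2)" by (simp only: sum_distrib_left)
      also have "\<dots> \<le> D * sqrt (real n) * (2 / R)" using that(3) D(1) by (intro mult_left_mono) auto
      finally show ?thesis .
    qed
    have above: "(\<Sum>j\<in>Above. hit j n) \<le> D * sqrt (real n) * (2 / R)"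
      using R by (intro far sum_inverse_square_above) (auto simp: Above_def)
    have below: "(\<Sum>j\<in>Below. hit j n) \<le> D * sqrt (real n) * (2 / R)"
      using R by (intro far sum_inverse_square_below) (auto simp: Below_def)
    have near: "(\<Sum>j\<in>Near. hit j n) \<le> 3 * R * M"
    proof -
      have "(\<Sum>j\<in>Near. hit j n) \<le> real (card Near) * M"
        using kmax by (intro sum_bounded_above) (auto simp: Near_def)
      also have "\<dots> \<le> 3 * R * M"
        using card_nat_near_le[of Near t R] R by (intro mult_right_mono) (auto simp: Near_def M_def hit_nonneg)
      finally show ?thesis .
    qed
    have "c \<le> (\<Sum>j\<le>n. hit j n)" using c(2)[of n] by (simp add: renewal_def)
    also have "\<dots> = (\<Sum>j\<in>{1..n}. hit j n)"
      using n by (intro sum.mono_neutral_right) (auto simp: hit_def Suc_le_eq)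
    also have "{1..n} = Near \<union> Above \<union> Below"
      by (auto simp: Near_def Above_def Below_def)
    also have "(\<Sum>j\<in>Near \<union> Above \<union> Below. hit j n) \<le> (\<Sum>j\<in>Near. hit j n) + (\<Sum>j\<in>Above. hit j n) + (\<Sum>j\<in>Below. hit j n)"
    proof -
      have "finite Near" "finite Above" "finite Below" by (auto simp: Near_def Above_def Below_def)
      moreover have "Near \<inter> Above = {}" "(Near \<union> Above) \<inter> Below = {}"
        using R by (auto simp: Near_def Above_def Below_def)
      ultimately show ?thesis by (simp add: sum.union_disjoint)
    qed
    also have "\<dots> \<le> 3 * R * M + D * sqrt (real n) * (2 / R) + D * sqrt (real n) * (2 / R)"
      by (intro add_mono near above below)
    also have "\<dots> = 3 * R * M + 4 * D / K" using n0 K by (simp add: R_def)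
    also have "4 * D / K \<le> c / 2"
      using K c D by (simp add: field_simps)
    finally have M: "c / 2 \<le> 3 * R * M" by simp
    have "c * (real k - t)\<^sup>2 \<le> 6 * R * M * (real k - t)\<^sup>2"
      using M by (intro mult_right_mono) auto
    also have "\<dots> = 6 * R * (M * (real k - t)\<^sup>2)" by simp
    also have "\<dots> \<le> 6 * R * (D * sqrt (real n))"
      using decay[OF k1] R by (intro mult_left_mono) (auto simp: M_def)
    also have "\<dots> = 6 * K * D * real n" by (simp add: R_def)
    finally have "(real k - t)\<^sup>2 \<le> 6 * K * D / c * real n" using c by (simp add: field_simps)
    then have "\<bar>real k - t\<bar> \<le> C * sqrt (real n)"
      unfolding C_def real_sqrt_mult[symmetric] by (rule real_le_rsqrt[of "\<bar>real k - t\<bar>", simplified])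
    then have "\<bar>real k - t\<bar> / real n \<le> C * sqrt (real n) / real n" by (rule divide_right_mono) simp
    also have "\<bar>real k - t\<bar> / real n = \<bar>real k / real n - 1 / mean\<bar>"
    proof -
      have "(real k - t) / real n = real k / real n - 1 / mean"
        using n by (simp add: t_def diff_divide_distrib)
      then show ?thesis by (metis abs_divide abs_of_nat)
    qed
    also have "C * sqrt (real n) / real n = C * real n powr (- 1 / 2)"
      using n by (simp add: powr_minus powr_half_sqrt real_sqrt_divide field_simps)
    finally show ?thesis .
  qed
  then show ?thesis by blast
qed

end

section \<open>The critical fugacity\<close>

text \<open>The update \<open>a(0 := 0)\<close> makes \<open>A\<close> a power series indexed from \<open>0\<close>, for which continuity and coefficientwise
  products are available.\<close>

lemma gen_fun_powser: "gen_fun a x = (\<Sum>n. ennreal ((a(0 := 0)) n * x ^ n))"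
  unfolding gen_fun_def
  using suminf_offset[of "\<lambda>n. ennreal ((a(0 := 0)) n * x ^ n)" 1] by simp

text \<open>Every term of \<open>A\<close> has degree at least one, so \<open>A(x) / x\<close> is nondecreasing.  This makes \<open>A\<close> strictly
  increasing where it is finite and lets it take arbitrarily small values.\<close>

lemma gen_fun_scale:
  assumes pos: "\<And>j. 1 \<le> j \<Longrightarrow> 0 < a j" and x: "0 < x" "x \<le> y"
  shows "gen_fun a x \<le> ennreal (x / y) * gen_fun a y"
proof -
  have "a (Suc i) * x ^ Suc i \<le> x / y * (a (Suc i) * y ^ Suc i)" for i
  proof -
    have "x / y * (a (Suc i) * y ^ Suc i) = a (Suc i) * (x * y ^ i)"
      using x by simp
    moreover have "a (Suc i) * (x * x ^ i) \<le> a (Suc i) * (x * y ^ i)"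
      using x pos[of "Suc i"] by (intro mult_left_mono power_mono) auto
    ultimately show ?thesis by simp
  qed
  then have "ennreal (a (Suc i) * x ^ Suc i) \<le> ennreal (x / y) * ennreal (a (Suc i) * y ^ Suc i)" for i
    using x by (subst ennreal_mult'[symmetric]) (auto intro!: ennreal_leI)
  then show ?thesis
    unfolding gen_fun_def ennreal_suminf_cmult[symmetric]
    by (intro suminf_le summableI) auto
qed

context
  fixes a :: "nat \<Rightarrow> real"
  assumes pos: "\<And>j. 1 \<le> j \<Longrightarrow> 0 < a j"
begin

lemma powser_term_nonneg: "0 \<le> x \<Longrightarrow> 0 \<le> (a(0 := 0)) n * x ^ n"
  using pos[of n] by (cases n) auto

lemma finite_domain_iff_summable:
  assumes "0 < x"
  shows "x \<in> finite_domain a \<longleftrightarrow> summable (\<lambda>n. (a(0 := 0)) n * x ^ n)"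
proof
  assume "x \<in> finite_domain a"
  then have "(\<Sum>n. ennreal ((a(0 := 0)) n * x ^ n)) \<noteq> top"
    by (auto simp: finite_domain_def gen_fun_powser)
  then show "summable (\<lambda>n. (a(0 := 0)) n * x ^ n)"
    using powser_term_nonneg assms by (intro summable_suminf_not_top) auto
next
  assume "summable (\<lambda>n. (a(0 := 0)) n * x ^ n)"
  then show "x \<in> finite_domain a"
    using assms powser_term_nonneg[of x]
    by (simp add: finite_domain_def gen_fun_powser suminf_ennreal2 del: fun_upd_apply)
qed

lemma gen_fun_eq_suminf:
  assumes "x \<in> finite_domain a"
  shows "gen_fun a x = ennreal (\<Sum>n. (a(0 := 0)) n * x ^ n)"
proof -
  have "0 < x" using assms by (simp add: finite_domain_def)
  then show ?thesis
    unfolding gen_fun_powser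
    using assms finite_domain_iff_summable[of x] powser_term_nonneg[of x]
    by (intro suminf_ennreal2) auto
qed

lemma gen_fun_eq_1_unique:
  assumes "0 < x" "gen_fun a x = 1" "0 < y" "gen_fun a y = 1"
  shows "x = y"
proof -
  have *: "x = y" if "0 < x" "x \<le> y" "gen_fun a x = 1" "gen_fun a y = 1" for x y
  proof -
    have "ennreal 1 \<le> ennreal (x / y)" using gen_fun_scale[of a x y] pos that by simp
    then have "1 \<le> x / y" using that by (subst (asm) ennreal_le_iff) auto
    then show "x = y" using that by simp
  qed
  show ?thesis using *[of x y] *[of y x] assms by linarith
qed

text \<open>The root is the largest \<open>s\<close> with \<open>A(s) \<le> 1\<close>; the bound passes to the supremum because it holds for every
  partial sum.  Then \<open>s\<close> lies in the domain, and so does a point \<open>y > s\<close> by openness.  Hence \<open>A\<close> is continuous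
  at \<open>s\<close>, and \<open>A(s) < 1\<close> would leave room to the right of \<open>s\<close>.\<close>

lemma gen_fun_eq_1_exists:
  assumes ne: "finite_domain a \<noteq> {}" and op: "open (finite_domain a)"
  shows "\<exists>x>0. gen_fun a x = 1"
proof -
  define S where "S = {x. 0 < x \<and> gen_fun a x \<le> 1}"
  define f where "f = (\<lambda>x. \<Sum>n. (a(0 := 0)) n * x ^ n)"
  have f: "gen_fun a x = ennreal (f x)" if "x \<in> finite_domain a" for x
    using gen_fun_eq_suminf[OF that] by (simp only: f_def)
  have partial: "(\<Sum>n<m. (a(0 := 0)) n * x ^ n) \<le> 1" if "x \<in> S" for x m
  proof -
    have x: "0 < x" "gen_fun a x \<le> 1" using that by (auto simp: S_def)
    then have d: "x \<in> finite_domain a" by (auto simp: finite_domain_def intro: le_less_trans)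
    then have "f x \<le> 1" using x(2) f[OF d] by simp
    moreover have "(\<Sum>n<m. (a(0 := 0)) n * x ^ n) \<le> f x"
      unfolding f_def using d x finite_domain_iff_summable[of x] powser_term_nonneg[of x]
      by (intro sum_le_suminf) auto
    ultimately show ?thesis by linarith
  qed
  have "x \<le> 1 / a 1" if "x \<in> S" for x
    using partial[OF that, of 2] pos[of 1] by (simp add: numeral_2_eq_2 field_simps)
  then have bdd: "bdd_above S" by (auto simp: bdd_above_def)
  obtain x1 where x1: "x1 \<in> S"
  proof -
    obtain x0 where x0: "x0 \<in> finite_domain a" using ne by blast
    \<comment> \<open>Scaling \<open>x0\<close> down by \<open>G\<close> divides \<open>A\<close> by at least \<open>G\<close>.\<close>
    define G where "G = max 1 (f x0)"
    have G: "0 < G" "f x0 \<le> G" unfolding G_def by linarith+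
    have x0': "0 < x0" using x0 by (simp add: finite_domain_def)
    have "gen_fun a (x0 / G) \<le> ennreal (x0 / G / x0) * gen_fun a x0"
      using pos x0' by (intro gen_fun_scale) (auto simp: G_def field_simps)
    also have "\<dots> = ennreal (f x0 / G)"
      using x0' G by (simp add: f[OF x0] ennreal_mult'[symmetric])
    also have "\<dots> \<le> ennreal 1" using G by (intro ennreal_leI) simp
    finally have "x0 / G \<in> S" using x0' G by (simp add: S_def)
    then show thesis by (rule that)
  qed
  define s where "s = Sup S"
  have s0: "0 < s"
    using x1 cSup_upper[OF x1 bdd] by (auto simp: s_def S_def)
  have "(\<Sum>n<m. (a(0 := 0)) n * s ^ n) \<le> 1" for m
  proof -
    have "closed {x. (\<Sum>n<m. (a(0 := 0)) n * x ^ n) \<le> 1}"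
      by (intro closed_Collect_le continuous_intros)
    then have "s \<in> {x. (\<Sum>n<m. (a(0 := 0)) n * x ^ n) \<le> 1}"
      unfolding s_def using x1 bdd partial by (intro closed_subset_contains_Sup) auto
    then show ?thesis by simp
  qed
  then have "(\<Sum>n<m. ennreal ((a(0 := 0)) n * s ^ n)) \<le> 1" for m
    using powser_term_nonneg[of s] s0 by (subst sum_ennreal) (auto simp: ennreal_le_1)
  then have le: "gen_fun a s \<le> 1"
    unfolding gen_fun_powser by (intro suminf_le_const summableI)
  then have d: "s \<in> finite_domain a" using s0 by (auto simp: finite_domain_def intro: le_less_trans)
  obtain e where e: "0 < e" "ball s e \<subseteq> finite_domain a" using op d by (rule openE)
  define y where "y = s + e / 2"
  have y: "s < y" "0 < y" "y \<in> finite_domain a"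
    using e s0 by (auto simp: y_def dist_real_def intro!: subsetD[OF e(2)])
  have "isCont f s"
    unfolding f_def using y s0 finite_domain_iff_summable[of y]
    by (intro isCont_powser[of _ y]) auto
  have "\<not> f s < 1"
  proof
    assume "f s < 1"
    have "(f \<longlongrightarrow> f s) (at_right s)"
      using \<open>isCont f s\<close> by (simp add: isCont_def filterlim_at_split)
    then have "\<forall>\<^sub>F x in at_right s. f x < 1" using \<open>f s < 1\<close> by (rule order_tendstoD)
    moreover have "\<forall>\<^sub>F x in at_right s. x \<in> {s<..<y}" using y by (intro eventually_at_right_real)
    ultimately have "\<forall>\<^sub>F x in at_right s. f x < 1 \<and> x \<in> {s<..<y}" by (rule eventually_conj)
    then obtain x where x: "f x < 1" "s < x" "x < y"
      using eventually_happens'[of "at_right s"] by (auto simp: trivial_limit_at_right_real)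
    have "x \<in> finite_domain a"
      using e x s0 by (auto simp: y_def dist_real_def intro!: subsetD[OF e(2)])
    then have "gen_fun a x \<le> 1"
      using x by (simp add: f)
    then have "x \<in> S" using x s0 by (simp add: S_def)
    then show False using cSup_upper[OF _ bdd, of x] x by (simp add: s_def)
  qed
  then have "1 \<le> gen_fun a s"
    by (simp add: f[OF d])
  then show ?thesis using le s0 by (intro exI[of _ s]) (auto intro: antisym)
qed

section \<open>The tilted weights as a site law\<close>

lemma pmf_site_law_eq:
  assumes "0 < x" "gen_fun a x = 1"
  shows "pmf (site_law a x) = (\<lambda>j. (a(0 := 0)) j * x ^ j)"
proof
  fix j
  have "x \<in> finite_domain a" using assms by (simp add: finite_domain_def)
  then show "pmf (site_law a x) j = (a(0 := 0)) j * x ^ j"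
    using pmf_site_law[of a x j, OF pos] assms by simp
qed

lemma summable_square_times_powser:
  assumes x: "0 < x" "x < y" and s: "summable (\<lambda>n. (a(0 := 0)) n * y ^ n)"
  shows "summable (\<lambda>n. (real n)\<^sup>2 * ((a(0 := 0)) n * x ^ n))"
proof -
  define r where "r = x / y"
  have r: "0 < r" "r < 1" using x by (auto simp: r_def)
  have "(\<lambda>n. (real n)\<^sup>2 * r ^ n) \<longlonglongrightarrow> 0" using r by real_asymp
  then have "Bseq (\<lambda>n. (real n)\<^sup>2 * r ^ n)" by (intro convergent_imp_Bseq convergentI)
  then obtain B where B: "\<And>n. \<bar>(real n)\<^sup>2 * r ^ n\<bar> \<le> B" by (auto simp: Bseq_def)
  show ?thesis
  proof (rule summable_comparison_test')
    show "summable (\<lambda>n. B * ((a(0 := 0)) n * y ^ n))" using s by (rule summable_mult)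
    fix n
    have "(real n)\<^sup>2 * ((a(0 := 0)) n * x ^ n) = ((real n)\<^sup>2 * r ^ n) * ((a(0 := 0)) n * y ^ n)"
      using x by (simp add: r_def power_divide)
    also have "\<dots> \<le> B * ((a(0 := 0)) n * y ^ n)"
      using B[of n] x powser_term_nonneg[of y n] by (intro mult_right_mono) auto
    finally show "norm ((real n)\<^sup>2 * ((a(0 := 0)) n * x ^ n)) \<le> B * ((a(0 := 0)) n * y ^ n)"
      using x powser_term_nonneg[of x n] by (simp only: real_norm_def abs_of_nonneg mult_nonneg_nonneg zero_le_power2)
  qed
qed

text \<open>Openness provides convergence at some point beyond \<open>x\<close>, and the geometric gain absorbs the factor \<open>j\<^sup>2\<close> of the
  second moment.\<close>

lemma site_sequence_site_law:
  assumes op: "open (finite_domain a)" and x: "0 < x" "gen_fun a x = 1"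
  shows "site_sequence (pmf (site_law a x))"
proof
  have d: "x \<in> finite_domain a" using x by (simp add: finite_domain_def)
  note q = pmf_site_law_eq[OF x]
  show "pmf (site_law a x) 0 = 0" unfolding q by simp
  show "0 < pmf (site_law a x) j" if "1 \<le> j" for j
    unfolding q using that pos[of j] x by simp
  have "(\<Sum>n. (a(0 := 0)) n * x ^ n) = 1"
    using x(2) unfolding gen_fun_eq_suminf[OF d] by (simp add: ennreal_eq_1)
  then show "pmf (site_law a x) sums 1"
    unfolding q using d finite_domain_iff_summable[OF x(1)] by (simp add: sums_iff)
  obtain e where e: "0 < e" "ball x e \<subseteq> finite_domain a" using op d by (rule openE)
  then have "x + e / 2 \<in> finite_domain a" by (intro subsetD[OF e(2)]) (auto simp: dist_real_def)
  then show "summable (\<lambda>j. (real j)\<^sup>2 * pmf (site_law a x) j)"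
    unfolding q using e x finite_domain_iff_summable[of "x + e / 2"]
    by (intro summable_square_times_powser[of x "x + e / 2"]) auto
qed

end

section \<open>Partition functions as convolution powers\<close>

text \<open>Splitting off the first part of a composition is multiplication by one more factor of the series.\<close>

lemma partition_fun_eq_fps_power: "partition_fun a n k = (Abs_fps (a(0 := 0)) ^ k) $ n"
proof (induction k arbitrary: n)
  case 0
  have "compositions n 0 = (if n = 0 then {[]} else {})"
    by (auto simp: compositions_def)
  then show ?case by (simp add: partition_fun_def)
next
  case (Suc k)
  have "(Abs_fps (a(0 := 0)) ^ Suc k) $ n = (\<Sum>i=0..n. (a(0 := 0)) i * partition_fun a (n - i) k)"
    by (simp add: fps_mult_nth Suc del: fun_upd_apply)
  also have "\<dots> = (\<Sum>i=1..n. a i * partition_fun a (n - i) k)"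
    by (intro sum.mono_neutral_cong_right) auto
  also have "\<dots> = (\<Sum>(i, js)\<in>(SIGMA i:{1..n}. compositions (n - i) k). a i * prod_list (map a js))"
    unfolding partition_fun_def sum_distrib_left
    by (intro sum.Sigma) (auto simp: finite_compositions)
  also have "\<dots> = (\<Sum>js\<in>compositions n (Suc k). prod_list (map a js))"
    by (rule sum.reindex_bij_witness[of _ "\<lambda>js. (hd js, tl js)" "\<lambda>(i, js). i # js"])
      (auto simp: compositions_def length_Suc_conv)
  finally show ?case by (simp only: partition_fun_def)
qed

lemma partition_fun_times_power:
  "partition_fun (\<lambda>j. a j * x ^ j) n k = x ^ n * partition_fun a n k"
proof -
  have "prod_list (map (\<lambda>j. a j * x ^ j) js) = x ^ sum_list js * prod_list (map a js)" for js
    by (induction js) (auto simp: power_add)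
  then show ?thesis
    by (auto simp: partition_fun_def sum_distrib_left compositions_def intro!: sum.cong)
qed

section \<open>The maximizing support fraction\<close>

lemma ex_is_maximizer: "1 \<le> n \<Longrightarrow> \<exists>k. is_maximizer a n k"
proof -
  assume n: "1 \<le> n"
  then have "Max (partition_fun a n ` {1..n}) \<in> partition_fun a n ` {1..n}"
    by (intro Max_in) auto
  then obtain k where "k \<in> {1..n}" "Max (partition_fun a n ` {1..n}) = partition_fun a n k"
    by blast
  then have "is_maximizer a n k"
    by (auto simp: is_maximizer_def is_arg_max_linorder) (metis Max_ge atLeastAtMost_iff finite_atLeastAtMost finite_imageI imageI)
  then show ?thesis ..
qed

lemma maximizing_support_fractionI:
  assumes "\<And>n k. 1 \<le> n \<Longrightarrow> is_maximizer a n k \<Longrightarrow> \<bar>real k / real n - \<alpha>\<bar> \<le> c * real n powr (- 1 / 2)"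
  shows "maximizing_support_fraction a \<alpha>"
  unfolding maximizing_support_fraction_def
proof (intro allI impI)
  fix k :: "nat \<Rightarrow> nat" assume k: "\<forall>n\<ge>1. is_maximizer a n (k n)"
  have "(\<lambda>n. real (k n) / real n - \<alpha>) \<longlonglongrightarrow> 0"
  proof (rule Lim_null_comparison)
    show "\<forall>\<^sub>F n in sequentially. norm (real (k n) / real n - \<alpha>) \<le> c * real n powr (- 1 / 2)"
      using eventually_ge_at_top[of 1] by eventually_elim (use assms k in auto)
    show "(\<lambda>n. c * real n powr (- 1 / 2)) \<longlonglongrightarrow> 0" by real_asymp
  qed
  then show "(\<lambda>n. real (k n) / real n) \<longlonglongrightarrow> \<alpha>" by (simp add: LIM_zero_iff)
qed

text \<open>The defining condition speaks about all sequences of maximizers, so uniqueness of the limit depends on there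
  being such a sequence.\<close>

lemma maximizing_support_fraction_unique:
  assumes "maximizing_support_fraction a \<alpha>" "maximizing_support_fraction a \<beta>"
  shows "\<alpha> = \<beta>"
proof -
  obtain k where "\<forall>n\<ge>1. is_maximizer a n (k n)" using ex_is_maximizer[of _ a] by metis
  with assms show ?thesis unfolding maximizing_support_fraction_def by (blast intro: LIMSEQ_unique)
qed

lemma integrable_pmf_nat_iff:
  "integrable (measure_pmf p) real \<longleftrightarrow> summable (\<lambda>j. real j * pmf p j)"
  by (simp add: measure_pmf_eq_density integrable_density integrable_count_space_nat_iff mult.commute)

lemma expectation_pmf_nat:
  assumes "summable (\<lambda>j. real j * pmf p j)"
  shows "measure_pmf.expectation p real = (\<Sum>j. real j * pmf p j)"
  using assms
  by (simp add: measure_pmf_eq_density integral_density integral_count_space_nat integrable_count_space_nat_iff mult.commute)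

text \<open>One constant for all weights with the same site law: the property by which it is chosen mentions \<open>p\<close> only.\<close>

definition rate_constant :: "nat pmf \<Rightarrow> real" where
  "rate_constant p = (SOME C. \<forall>n k. 1 \<le> n \<and>
     is_arg_max (\<lambda>k. site_sequence.hit (pmf p) k n) (\<lambda>k. 1 \<le> k \<and> k \<le> n) k \<longrightarrow>
     \<bar>real k / real n - 1 / site_sequence.mean (pmf p)\<bar> \<le> C * real n powr (- 1 / 2))"

text \<open>The factor \<open>x ^ n\<close> between \<open>hit k n\<close> and the partition function does not depend on \<open>k\<close>, so both have the same
  maximizers.\<close>

lemma is_maximizer_near_mean:
  assumes pos: "\<And>j. 1 \<le> j \<Longrightarrow> 0 < a j" and op: "open (finite_domain a)"
    and x: "0 < x" "gen_fun a x = 1" and n: "1 \<le> n" and k: "is_maximizer a n k"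
  shows "\<bar>real k / real n - 1 / measure_pmf.expectation (site_law a x) real\<bar>
    \<le> rate_constant (site_law a x) * real n powr (- 1 / 2)"
proof -
  interpret site_sequence "pmf (site_law a x)"
    using pos op x by (rule site_sequence_site_law)
  have law: "pmf (site_law a x) = (\<lambda>j. a j * x ^ j)(0 := 0)"
    using pmf_site_law_eq[OF pos x] by auto
  have hit: "hit j n = x ^ n * partition_fun a n j" for j
    unfolding partition_fun_times_power[symmetric]
    unfolding hit_def partition_fun_eq_fps_power unfolding law ..
  have "is_arg_max (\<lambda>k. hit k n) (\<lambda>k. 1 \<le> k \<and> k \<le> n) k"
    using k x by (simp add: is_maximizer_def is_arg_max_linorder hit)
  moreover have "measure_pmf.expectation (site_law a x) real = mean"
    by (simp add: expectation_pmf_nat first_moment_summable mean_def)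
  moreover have "\<forall>n k. 1 \<le> n \<and> is_arg_max (\<lambda>k. hit k n) (\<lambda>k. 1 \<le> k \<and> k \<le> n) k \<longrightarrow>
      \<bar>real k / real n - 1 / mean\<bar> \<le> rate_constant (site_law a x) * real n powr (- 1 / 2)"
    unfolding rate_constant_def by (rule someI_ex) (rule arg_max_hit_near_mean)
  ultimately show ?thesis using n by simp
qed

theorem theorem1:
  "\<exists>C :: nat pmf \<Rightarrow> real. \<forall>a :: nat \<Rightarrow> real.
     (\<forall>j\<ge>1. 0 < a j) \<and> finite_domain a \<noteq> {} \<and> open (finite_domain a) \<longrightarrow>
       (\<exists>!x. 0 < x \<and> gen_fun a x = 1) \<and>
       (\<forall>x \<alpha>. 0 < x \<and> gen_fun a x = 1 \<and> \<alpha> = 1 / measure_pmf.expectation (site_law a x) real \<longrightarrow>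
          integrable (measure_pmf (site_law a x)) real \<and>
          (\<exists>!\<beta>. maximizing_support_fraction a \<beta>) \<and>
          maximizing_support_fraction a \<alpha> \<and>
          (\<forall>n k. 1 \<le> n \<and> is_maximizer a n k \<longrightarrow>
             \<bar>real k / real n - \<alpha>\<bar> \<le> C (site_law a x) * real n powr (- 1 / 2)))"
proof (intro exI[of _ rate_constant] allI impI conjI; elim conjE)
  fix a :: "nat \<Rightarrow> real"
  assume pos: "\<forall>j\<ge>1. 0 < a j" and ne: "finite_domain a \<noteq> {}" and op: "open (finite_domain a)"
  show "\<exists>!x. 0 < x \<and> gen_fun a x = 1"
    using gen_fun_eq_1_exists[of a] gen_fun_eq_1_unique[of a] pos ne op by blast
  fix x \<alpha> :: real
  assume x: "0 < x" "gen_fun a x = 1"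
    and \<alpha>: "\<alpha> = 1 / measure_pmf.expectation (site_law a x) real"
  interpret site_sequence "pmf (site_law a x)"
    using pos op x by (intro site_sequence_site_law) auto
  show "integrable (measure_pmf (site_law a x)) real"
    by (simp add: integrable_pmf_nat_iff first_moment_summable)
  show rate: "\<bar>real k / real n - \<alpha>\<bar> \<le> rate_constant (site_law a x) * real n powr (- 1 / 2)"
    if "1 \<le> n" "is_maximizer a n k" for n k
    unfolding \<alpha> using pos op x that by (intro is_maximizer_near_mean) auto
  show fraction: "maximizing_support_fraction a \<alpha>"
    using rate by (rule maximizing_support_fractionI)
  show "\<exists>!\<beta>. maximizing_support_fraction a \<beta>"
    using fraction maximizing_support_fraction_unique by blast
qed

end
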